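(* Let $\mathcal A=\text{Ising}\times\overline{\text{Ising}}$, with the boson $\gamma=(\psi,\psi)$ condensed, and let $e=u_+$, $m=u_-$, $\chi$, $\tilde\chi$ be the sectors of the broken phase $\mathcal T$ described in the context. Let $V$ be the complex vector space with basis $|\sigma\sigma,b;c\rangle$, $b\in\{1\sigma,\psi\sigma\}$, $c\in\{\sigma1,\sigma\psi\}$, whose elements represent the fusion vertices of $\mathcal A$ with upper legs $\sigma\sigma, b$ and lower leg $c$. Let $$v_\pm=\pm e^{-i\pi/4}\,|\sigma\sigma,1\sigma;\sigma1\rangle+|\sigma\sigma,1\sigma;\sigma\psi\rangle+|\sigma\sigma,\psi\sigma;\sigma1\rangle\mp e^{i\pi/4}\,|\sigma\sigma,\psi\sigma;\sigma\psi\rangle$$ be the lift to $\mathcal A$ of the $\mathcal T$ vertex with upper legs $u_\pm,\chi$ and lower leg $\tilde\chi$. Let $M_{\mathcal A}:V\to V$ be the monodromy, $M_{\mathcal A}|a,b;c\rangle=\frac{\theta_c}{\theta_a\theta_b}|a,b;c\rangle$. Then $$M_{\mathcal A}v_+=-e^{i\pi/4}\,v_-,\qquad M_{\mathcal A}v_-=-e^{i\pi/4}\,v_+ .$$ That is, the monodromy with the confined sector $\chi$ acts on the pair of sectors $(e,m)$ by $-e^{i\pi/4}\sigma_x$, where $\sigma_x$ is the Pauli matrix exchanging $e$ and $m$.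
   Context: The Ising theory has sectors $1,\sigma,\psi$ with fusion rules $\sigma\times\sigma=1+\psi$, $\psi\times\psi=1$, $\sigma\times\psi=\sigma$ and topological spins $h_1=0$, $h_\sigma=1/16$, $h_\psi=1/2$. The theory $\overline{\text{Ising}}$ has the same sectors and fusion rules with opposite spins. The sectors of $\mathcal A=\text{Ising}\times\overline{\text{Ising}}$ are pairs $ab=(a,b)$ with $a,b\in\{1,\sigma,\psi\}$, with componentwise fusion. The spin of $ab$ is $h_{ab}=h_a-h_b$ (with $h$ the Ising spins, the second factor contributing with a minus sign), and $\theta_{ab}=e^{2\pi i h_{ab}}$ depends only on $h_{ab}$ modulo $1$. In particular $\theta_{\sigma\sigma}=1$, $\theta_{\sigma1}=e^{i\pi/8}$, $\theta_{1\sigma}=e^{-i\pi/8}$, $\theta_{\sigma\psi}=e^{-7\pi i/8}$, $\theta_{\psi\sigma}=e^{7\pi i/8}$. Condensing the boson $(\psi,\psi)$ identifies sectors of $\mathcal A$ related by fusion with $(\psi,\psi)$ and splits the fixed sector $\sigma\sigma$. The sectors of the resulting phase $\mathcal T$, with their lifts to $\mathcal A$, are: the vacuum (lifts $11,\psi\psi$); $e=u_+$ and $m=u_-$ (each with the single lift $\sigma\sigma$); the fermion $f$ (lifts $\psi1,1\psi$); and the confined sectors $\chi$ (lifts $1\sigma,\psi\sigma$) and $\tilde\chi$ (lifts $\sigma1,\sigma\psi$). The unconfined sectors (vacuum, $e$, $m$, $f$) form the $\mathbb Z_2$ toric code. The lift of a $\mathcal T$ vertex with upper legs $r,s$ and lower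 leg $t$ is a linear combination of the $\mathcal A$ vertices with upper legs $a,b$ and lower leg $c$, where $a,b,c$ range over lifts of $r,s,t$. The coefficients (vertex lifting coefficients) in the case used here are those displayed in $v_\pm$. *)

theory Defs
  imports "HOL-Analysis.Analysis"
begin

datatype ising = IsOne | IsSigma | IsPsi

type_synonym asector = "ising \<times> ising"

text \<open>The theory is multiplicity free, so a fusion product is the set of its channels.\<close>

fun ising_fusion :: "ising \<Rightarrow> ising \<Rightarrow> ising set" where
  "ising_fusion IsOne a = {a}"
| "ising_fusion a IsOne = {a}"
| "ising_fusion IsSigma IsSigma = {IsOne, IsPsi}"
| "ising_fusion IsPsi IsPsi = {IsOne}"
| "ising_fusion IsSigma IsPsi = {IsSigma}"
| "ising_fusion IsPsi IsSigma = {IsSigma}"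

definition fusion :: "asector \<Rightarrow> asector \<Rightarrow> asector set" where
  "fusion a b = ising_fusion (fst a) (fst b) \<times> ising_fusion (snd a) (snd b)"

fun ising_spin :: "ising \<Rightarrow> real" where
  "ising_spin IsOne = 0"
| "ising_spin IsSigma = 1 / 16"
| "ising_spin IsPsi = 1 / 2"

definition spin :: "asector \<Rightarrow> real" where
  "spin a = ising_spin (fst a) - ising_spin (snd a)"

definition twist :: "asector \<Rightarrow> complex" where
  "twist a = exp (2 * complex_of_real pi * \<i> * complex_of_real (spin a))"

definition boson :: asector where
  "boson = (IsPsi, IsPsi)"

text \<open>
  The two pieces into which the fixed sector splits are \<open>e = u\<^sub>+\<close> and \<open>m = u\<^sub>-\<close>;
  \<open>TChi'\<close> stands for the sector written \<open>\<chi>\<close> with a tilde.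
\<close>

datatype tsector = TVac | TE | TM | TF | TChi | TChi'

datatype sgn2 = Plus | Minus

fun u :: "sgn2 \<Rightarrow> tsector" where
  "u Plus = TE"
| "u Minus = TM"

fun lifts :: "tsector \<Rightarrow> asector set" where
  "lifts TVac = {(IsOne, IsOne), (IsPsi, IsPsi)}"
| "lifts TE = {(IsSigma, IsSigma)}"
| "lifts TM = {(IsSigma, IsSigma)}"
| "lifts TF = {(IsPsi, IsOne), (IsOne, IsPsi)}"
| "lifts TChi = {(IsOne, IsSigma), (IsPsi, IsSigma)}"
| "lifts TChi' = {(IsSigma, IsOne), (IsSigma, IsPsi)}"

lemma lifts_orbit: "a \<in> lifts t \<Longrightarrow> lifts t = insert a (fusion boson a)"
  by (cases t) (auto simp: fusion_def boson_def)

text \<open>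
  A vertex is a triple (left upper leg, right upper leg, lower leg).
\<close>

definition lift_vertices ::
    "tsector \<Rightarrow> tsector \<Rightarrow> tsector \<Rightarrow> (asector \<times> asector \<times> asector) set" where
  "lift_vertices r s t =
     {(a, b, c). a \<in> lifts r \<and> b \<in> lifts s \<and> c \<in> lifts t \<and> c \<in> fusion a b}"

typedef vertex =
  "{(IsSigma, IsSigma)} \<times> {(IsOne, IsSigma), (IsPsi, IsSigma)}
     \<times> {(IsSigma, IsOne), (IsSigma, IsPsi)}"
  by blast

lemma range_Rep_vertex: "range Rep_vertex = lift_vertices (u s) TChi TChi'"
proof -
  have "range Rep_vertex = {(IsSigma, IsSigma)} \<times> {(IsOne, IsSigma), (IsPsi, IsSigma)}
     \<times> {(IsSigma, IsOne), (IsSigma, IsPsi)}"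
    by (rule type_definition.Rep_range[OF type_definition_vertex])
  then show ?thesis
    by (cases s) (auto simp: lift_vertices_def fusion_def)
qed

instance vertex :: finite
proof
  have "finite (range Rep_vertex)"
    by (subst type_definition.Rep_range[OF type_definition_vertex]) simp
  then show "finite (UNIV :: vertex set)"
    by (rule finite_imageD) (simp add: inj_on_def Rep_vertex_inject)
qed

type_synonym vertex_space = "complex ^ vertex"

text \<open>
  \<open>ket a b c\<close> is meaningful only if \<open>(a, b, c)\<close> lies in the carrier of \<open>vertex\<close>;
  otherwise \<open>Abs_vertex\<close> is unspecified.
\<close>

definition ket :: "asector \<Rightarrow> asector \<Rightarrow> asector \<Rightarrow> vertex_space" where
  "ket a b c = axis (Abs_vertex (a, b, c)) 1"

definition monodromy :: "vertex_space \<Rightarrow> vertex_space" where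
  "monodromy v = (\<chi> x. case Rep_vertex x of (a, b, c) \<Rightarrow>
     twist c / (twist a * twist b) * v $ x)"

lemma linear_monodromy: "Vector_Spaces.linear (*s) (*s) monodromy"
  by unfold_locales
    (auto simp: monodromy_def vec_eq_iff algebra_simps add_divide_distrib split: prod.split)

lemma monodromy_ket:
  assumes "(a, b, c) \<in> range Rep_vertex"
  shows "monodromy (ket a b c) = (twist c / (twist a * twist b)) *s ket a b c"
proof -
  have "Rep_vertex (Abs_vertex (a, b, c)) = (a, b, c)"
    using assms by (metis Rep_vertex_inverse imageE)
  then show ?thesis
    by (auto simp: monodromy_def ket_def vec_eq_iff axis_def)
qed

definition v_plus :: vertex_space where
  "v_plus =
     exp (- (\<i> * complex_of_real pi / 4)) *s ket (IsSigma, IsSigma) (IsOne, IsSigma) (IsSigma, IsOne)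
     + ket (IsSigma, IsSigma) (IsOne, IsSigma) (IsSigma, IsPsi)
     + ket (IsSigma, IsSigma) (IsPsi, IsSigma) (IsSigma, IsOne)
     - exp (\<i> * complex_of_real pi / 4) *s ket (IsSigma, IsSigma) (IsPsi, IsSigma) (IsSigma, IsPsi)"

definition v_minus :: vertex_space where
  "v_minus =
     - (exp (- (\<i> * complex_of_real pi / 4)) *s ket (IsSigma, IsSigma) (IsOne, IsSigma) (IsSigma, IsOne))
     + ket (IsSigma, IsSigma) (IsOne, IsSigma) (IsSigma, IsPsi)
     + ket (IsSigma, IsSigma) (IsPsi, IsSigma) (IsSigma, IsOne)
     + exp (\<i> * complex_of_real pi / 4) *s ket (IsSigma, IsSigma) (IsPsi, IsSigma) (IsSigma, IsPsi)"

text \<open>\<open>vertex_lift s\<close> is the lift of the vertex with upper legs \<open>u s\<close>, \<open>\<chi>\<close>.\<close>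

fun vertex_lift :: "sgn2 \<Rightarrow> vertex_space" where
  "vertex_lift Plus = v_plus"
| "vertex_lift Minus = v_minus"

lemma UNIV_sgn2: "UNIV = {Plus, Minus}"
  by (auto intro: sgn2.exhaust)

instance sgn2 :: finite
  by standard (simp add: UNIV_sgn2)

text \<open>The Pauli matrix, with rows and columns indexed by the pair \<open>(e, m) = (u\<^sub>+, u\<^sub>-)\<close>.\<close>

definition sigma_x :: "complex ^ sgn2 ^ sgn2" where
  "sigma_x = (\<chi> r s. if r = s then 0 else 1)"

end

theory Submission
  imports Defs
begin

text \<open>The monodromy is diagonal in the given basis, so only its four eigenvalues matter. On
  the ket with b = (p, \<sigma>) and c = (\<sigma>, q), p and q in {1, \<psi>}, the spin difference
  is 1/8 - h_p - h_q, so each \<psi> costs a half turn: the eigenvalue is e^{i\<pi>/4} for p = q and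
  -e^{i\<pi>/4} otherwise (\<open>monodromy_basis\<close>). Up to the factor -e^{i\<pi>/4}, the
  monodromy thus flips the sign of the p = q components and fixes the others. The vectors
  \<open>v_plus\<close> and \<open>v_minus\<close> differ by exactly this flip, so they are
  exchanged.\<close>

lemma twist_ratio:
  "twist c / (twist a * twist b)
     = exp (2 * complex_of_real pi * \<i> * complex_of_real (spin c - spin a - spin b))"
  by (simp add: twist_def exp_add [symmetric] exp_diff [symmetric] algebra_simps)

text \<open>The case of exactly one \<psi>: -3/8 = 1/8 - 1/2, and the half turn gives the
  sign.\<close>

lemma exp_minus_three_quarters_pi:
  "exp (2 * complex_of_real pi * \<i> * complex_of_real (- 3 / 8))
     = - exp (\<i> * complex_of_real pi / 4)"
proof -
  have "2 * complex_of_real pi * \<i> * complex_of_real (- 3 / 8)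
      = \<i> * complex_of_real pi / 4 - complex_of_real pi * \<i>"
    by (simp add: field_simps)
  then show ?thesis
    by (simp only: exp_diff exp_pi_i) simp
qed

text \<open>The case of two \<psi>: -7/8 = 1/8 - 1, so the two half turns cancel.\<close>

lemma exp_minus_seven_quarters_pi:
  "exp (2 * complex_of_real pi * \<i> * complex_of_real (- 7 / 8))
     = exp (\<i> * complex_of_real pi / 4)"
proof -
  have "2 * complex_of_real pi * \<i> * complex_of_real (- 7 / 8)
      = \<i> * complex_of_real pi / 4 - 2 * complex_of_real pi * \<i>"
    by (simp add: field_simps)
  then show ?thesis
    by (simp only: exp_diff exp_two_pi_i) simp
qed

lemma monodromy_basis:
  fixes b c :: ising
  assumes "b \<in> {IsOne, IsPsi}" "c \<in> {IsOne, IsPsi}"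
  shows "monodromy (ket (IsSigma, IsSigma) (b, IsSigma) (IsSigma, c))
    = (if b = c then exp (\<i> * complex_of_real pi / 4) else - exp (\<i> * complex_of_real pi / 4))
        *s ket (IsSigma, IsSigma) (b, IsSigma) (IsSigma, c)"
proof -
  \<comment> \<open>\<open>Abs_vertex\<close> is specified only on the carrier, so
    \<open>monodromy_ket\<close> needs this membership.\<close>
  have vertex: "((IsSigma, IsSigma), (b, IsSigma), (IsSigma, c)) \<in> range Rep_vertex"
    using assms by (auto simp: type_definition.Rep_range [OF type_definition_vertex])
  have "exp (2 * complex_of_real pi * \<i> * complex_of_real (1 / 8))
      = exp (\<i> * complex_of_real pi / 4)"
    by (simp add: mult_ac)
  \<comment> \<open>As \<sigma>\<sigma> has spin 0, this is (1/16 - h_c) - (h_b - 1/16), with h the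
    Ising spins.\<close>
  moreover have "spin (IsSigma, c) - spin (IsSigma, IsSigma) - spin (b, IsSigma)
      = (if b = c then if b = IsOne then 1 / 8 else - 7 / 8 else - 3 / 8)"
    using assms by (auto simp: spin_def)
  ultimately have "twist (IsSigma, c) / (twist (IsSigma, IsSigma) * twist (b, IsSigma))
      = (if b = c then exp (\<i> * complex_of_real pi / 4) else - exp (\<i> * complex_of_real pi / 4))"
    by (simp only: twist_ratio exp_minus_three_quarters_pi exp_minus_seven_quarters_pi split: if_split)
      simp
  then show ?thesis
    by (simp only: monodromy_ket [OF vertex])
qed

theorem mainTheorem1:
  "monodromy v_plus = (- exp (\<i> * complex_of_real pi / 4)) *s v_minus
   \<and> monodromy v_minus = (- exp (\<i> * complex_of_real pi / 4)) *s v_plus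
   \<and> (\<forall>s. monodromy (vertex_lift s) =
        (\<Sum>r\<in>UNIV. ((- exp (\<i> * complex_of_real pi / 4)) * sigma_x $ r $ s) *s vertex_lift r))"
proof -
  interpret linear: Vector_Spaces.linear "(*s)" "(*s)" monodromy
    by (rule linear_monodromy)
  note expand = linear.add linear.diff linear.neg linear.scale monodromy_basis
  have plus: "monodromy v_plus = (- exp (\<i> * complex_of_real pi / 4)) *s v_minus"
    by (simp add: v_plus_def v_minus_def expand vec_eq_iff algebra_simps)
  have minus: "monodromy v_minus = (- exp (\<i> * complex_of_real pi / 4)) *s v_plus"
    by (simp add: v_plus_def v_minus_def expand vec_eq_iff algebra_simps)
  \<comment> \<open>Column s of \<open>sigma_x\<close> is nonzero only at the opposite sign, so the
    sum collapses to \<open>plus\<close> or \<open>minus\<close>.\<close>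
  have "monodromy (vertex_lift s) =
      (\<Sum>r\<in>UNIV. ((- exp (\<i> * complex_of_real pi / 4)) * sigma_x $ r $ s) *s vertex_lift r)" for s
    by (cases s) (simp_all add: UNIV_sgn2 sigma_x_def plus minus)
  with plus minus show ?thesis
    by blast
qed

end
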